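(* The generating function for $S\left(2\mathbb{N}-1,n\right)$ is given by $$\sum_{n=1}^\infty S\left(2\mathbb{N}-1,n\right)q^n= -\frac{\left(-q;q^2\right)_\infty}{\left(q^2;q^2\right)_\infty} \sum_{n=1}^\infty \frac{\left(-q\right)^n}{\left(1-(-q)^n\right)^2}.$$
   Context: The identity is one of formal power series in $q$. The $q$-Pochhammer symbol is $(a;q)_\infty:=\prod_{m=0}^{\infty}(1-aq^m)$, so that $(-q;q^2)_\infty=\prod_{m\ge 0}(1+q^{2m+1})$ and $(q^2;q^2)_\infty=\prod_{m\ge 1}(1-q^{2m})$. $\mathbb{N}=\{1,2,3,\dots\}$ and $2\mathbb{N}-1=\{1,3,5,\dots\}$. A partition of $n\in\mathbb{N}$ is a non-increasing sequence $(\lambda_1,\dots,\lambda_s)$ of natural numbers (its parts) with $\sum_{j=1}^s\lambda_j=n$. For a subset $D\subset\mathbb{N}$, $S(D,n)\in\mathbb{Z}$ denotes the sum of all odd parts minus the sum of all even parts, taken over all partitions of $n$ in which parts from $D$ do not repeat (each element of $D$ occurs at most once as a part, while parts not in $D$ may repeat arbitrarily); parts are counted with multiplicity. Thus $S(2\mathbb{N}-1,n)$ concerns partitions of $n$ whose odd parts are distinct and whose even parts are unrestricted. *)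

theory Defs
  imports "HOL-Analysis.Analysis" "HOL-Computational_Algebra.Computational_Algebra"
begin

text \<open>
  Infinite sums and products of formal power series are taken with respect to the metric
  that the library puts on \<^typ>\<open>'a fps\<close>, i.e. they converge coefficientwise, each coefficient being eventually constant.
  In particular \<open>qpochhammer_inf a q\<close> converges whenever \<open>q\<close> has zero constant coefficient.
\<close>

definition qpochhammer_inf :: "'a::idom fps \<Rightarrow> 'a fps \<Rightarrow> 'a fps" where
  "qpochhammer_inf a q = (\<Prod>m. 1 - a * q ^ m)"

definition partitions :: "nat \<Rightarrow> nat list set" where
  "partitions n = {xs. sorted_wrt (\<ge>) xs \<and> (\<forall>x\<in>set xs. x \<ge> 1) \<and> sum_list xs = n}"

definition partitions_distinct_in :: "nat set \<Rightarrow> nat \<Rightarrow> nat list set" where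
  "partitions_distinct_in D n = {xs \<in> partitions n. \<forall>d\<in>D. count_list xs d \<le> 1}"

definition odd_minus_even :: "nat list \<Rightarrow> int" where
  "odd_minus_even xs = (\<Sum>x\<leftarrow>filter odd xs. int x) - (\<Sum>x\<leftarrow>filter even xs. int x)"

definition S :: "nat set \<Rightarrow> nat \<Rightarrow> int" where
  "S D n = (\<Sum>xs\<in>partitions_distinct_in D n. odd_minus_even xs)"

text \<open>The sum defining \<^const>\<open>S\<close> ranges over a finite set.\<close>

lemma finite_partitions: "finite (partitions n)"
proof (rule finite_subset)
  have "length xs \<le> sum_list xs" if "\<forall>x\<in>set xs. 1 \<le> x" for xs :: "nat list"
    using that by (induction xs) auto
  moreover have "set xs \<subseteq> {..sum_list xs}" for xs :: "nat list"
    by (auto intro: member_le_sum_list)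
  ultimately show "partitions n \<subseteq> {xs. set xs \<subseteq> {..n} \<and> length xs \<le> n}"
    unfolding partitions_def by blast
  show "finite {xs. set xs \<subseteq> {..n} \<and> length xs \<le> n}"
    by (rule finite_lists_length_le) simp
qed

lemma finite_partitions_distinct_in: "finite (partitions_distinct_in D n)"
  by (rule finite_subset[OF _ finite_partitions[of n]])
    (auto simp: partitions_distinct_in_def)

end

theory Submission
  imports Defs
begin

text \<open>
  Put \<open>x = - q\<close>. The right-hand side arises from logarithmic differentiation: marking every odd
  part \<open>k\<close> by \<open>z\<^sup>k\<close> and every even part \<open>k\<close> by \<open>z\<close> to the power \<open>- k\<close> turns the generating function of
  the partitions with distinct odd parts into a product over the part sizes \<open>k\<close>, and the derivative
  at \<open>z = 1\<close> is the unmarked product times a sum of one logarithmic derivative per \<open>k\<close>. A distinct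
  odd \<open>k\<close> contributes \<open>k q\<^sup>k / (1 + q\<^sup>k)\<close>, a repeatable even \<open>k\<close> contributes
  \<open>- k q\<^sup>k / (1 - q\<^sup>k)\<close>; both equal \<open>- k x\<^sup>k / (1 - x\<^sup>k)\<close>. Finally
  \<open>\<Sum>k x\<^sup>k / (1 - x\<^sup>k) = \<Sum>x\<^sup>k / (1 - x\<^sup>k)\<^sup>2\<close>, because in both series the coefficient
  of \<open>x\<^sup>n\<close> is the sum of the divisors of \<open>n\<close>.

  The proof replaces the differentiation by a recursion. Let \<open>A\<^sub>N\<close> count the admissible partitions
  with all parts at most \<open>N\<close>, and let \<open>B\<^sub>N\<close> sum the difference of odd and even parts over the same
  partitions. Removing one copy of the part \<open>N + 1\<close>, which stands at the head of the list if it
  occurs at all, expresses \<open>A\<close> and \<open>B\<close> at \<open>N + 1\<close> linearly through \<open>A\<close> and \<open>B\<close>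
  at \<open>N\<close> (\<open>count_fps_Suc\<close>, \<open>weight_fps_Suc\<close>). Induction on \<open>N\<close> then yields the finite
  product formula for \<open>A\<^sub>N\<close> (\<open>count_fps_odd\<close>) and
  \<open>B\<^sub>N = - A\<^sub>N L\<^sub>N\<close>, where \<open>L\<^sub>N\<close> sums \<open>k x\<^sup>k / (1 - x\<^sup>k)\<close> over \<open>1 \<le> k \<le> N\<close>
  (\<open>weight_fps_odd\<close>).
  Each coefficient stabilises as \<open>N\<close> grows, so the limit \<open>N \<rightarrow> \<infinity>\<close> together with
  \<open>lambert_series_identity\<close> gives the theorem.
\<close>

(* Without this, the infix $ could also denote a vector component. *)
unbundle no vec_syntax

section \<open>Limits of formal power series\<close>

lemma tendsto_fps_mult:
  fixes F G :: "'a::comm_ring_1 fps"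
  assumes "(f \<longlongrightarrow> F) net" "(g \<longlongrightarrow> G) net"
  shows "((\<lambda>x. f x * g x) \<longlongrightarrow> F * G) net"
proof (rule tendsto_fpsI)
  fix n
  have "\<forall>\<^sub>F x in net. \<forall>i\<in>{..n}. f x $ i = F $ i"
    using assms(1) by (intro eventually_ball_finite) (auto simp: tendsto_fps_iff)
  moreover have "\<forall>\<^sub>F x in net. \<forall>i\<in>{..n}. g x $ i = G $ i"
    using assms(2) by (intro eventually_ball_finite) (auto simp: tendsto_fps_iff)
  ultimately show "\<forall>\<^sub>F x in net. (f x * g x) $ n = (F * G) $ n"
    by eventually_elim (simp add: fps_mult_nth)
qed

lemma tendsto_fps_if_nth_stable:
  fixes f :: "nat \<Rightarrow> 'a::group_add fps"
  assumes "\<And>N n. n \<le> N \<Longrightarrow> f N $ n = F $ n"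
  shows "f \<longlonglongrightarrow> F"
  by (rule tendsto_fpsI) (use assms in \<open>auto simp: eventually_sequentially\<close>)

lemma fps_divide_eqI:
  fixes f g h :: "'a::field fps"
  assumes "h * g = f" "g $ 0 \<noteq> 0"
  shows "f / g = h"
proof -
  have "g \<noteq> 0" using assms(2) by auto
  then show ?thesis unfolding assms(1)[symmetric] by simp
qed

text \<open>
  The factor with index \<open>N\<close> differs from 1 only in coefficients above \<open>N\<close>, so the partial products
  stabilise coefficientwise. Their limit has constant coefficient 1 and is therefore nonzero,
  without which the partial products would not count as convergent for \<open>has_prod\<close>.
\<close>

lemma
  fixes a q :: "'a::idom fps"
  assumes a: "a $ 0 = 0" and q: "q $ 0 = 0"
  shows qpochhammer_inf_LIMSEQ: "(\<lambda>N. \<Prod>i<N. 1 - a * q ^ i) \<longlonglongrightarrow> qpochhammer_inf a q"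
    and qpochhammer_inf_nth_0: "qpochhammer_inf a q $ 0 = 1"
proof -
  define P where "P = (\<lambda>N. \<Prod>i<N. 1 - a * q ^ i)"
  have P_Suc: "P (Suc N) $ n = P N $ n" if "n \<le> N" for N n
  proof -
    have "(a * q ^ N) $ i = 0" if "i \<le> N" for i
    proof -
      have "a $ j * (q ^ N) $ (i - j) = 0" if "j \<le> i" for j
        using that \<open>i \<le> N\<close> a startsby_zero_power_prefix[OF q, of N] by (cases j) auto
      then show ?thesis
        unfolding fps_mult_nth by (intro sum.neutral) simp
    qed
    then have "(P N * (a * q ^ N)) $ n = 0"
      using that by (simp add: fps_mult_nth[of "P N"])
    then show ?thesis
      by (simp add: P_def algebra_simps)
  qed
  have stable: "P N $ n = P n $ n" if "n \<le> N" for N n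
    using that by (induction rule: dec_induct) (simp_all add: P_Suc)
  define F where "F = Abs_fps (\<lambda>n. P n $ n)"
  have lim: "P \<longlonglongrightarrow> F"
    unfolding F_def
    by (rule tendsto_fps_if_nth_stable) (unfold fps_nth_Abs_fps, rule stable)
  have F0: "F $ 0 = 1" by (simp add: F_def P_def)
  then have "F \<noteq> 0" by auto
  moreover have "(\<lambda>n. \<Prod>i\<le>n. 1 - a * q ^ i) \<longlonglongrightarrow> F"
    using LIMSEQ_Suc[OF lim] by (simp add: P_def lessThan_Suc_atMost)
  ultimately have "(\<lambda>i. 1 - a * q ^ i) has_prod F"
    by (simp add: has_prod_def raw_has_prod_def)
  then have F: "qpochhammer_inf a q = F"
    unfolding qpochhammer_inf_def by (rule has_prod_unique[symmetric])
  show "(\<lambda>N. \<Prod>i<N. 1 - a * q ^ i) \<longlonglongrightarrow> qpochhammer_inf a q"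
    using lim by (simp add: P_def F)
  show "qpochhammer_inf a q $ 0 = 1"
    using F0 by (simp add: F)
qed

section \<open>Lambert series\<close>

text \<open>
  These are the expansions of \<open>u / (1 - u)\<close> and \<open>u / (1 - u)\<^sup>2\<close> in powers of \<open>u\<close>, checked by
  multiplying the first series by \<open>1 - u\<close> to get \<open>u\<close> and the second one by \<open>1 - u\<close> to get the first.
\<close>

lemma fps_geometric_power_series:
  fixes c :: "'a::field"
  assumes "k \<ge> 1"
  defines "u \<equiv> (fps_const c * fps_X) ^ k"
  shows "u / (1 - u) = Abs_fps (\<lambda>j. if j \<ge> 1 \<and> k dvd j then c ^ j else 0)" (is "_ = ?V")
    and "u / (1 - u) ^ 2 = Abs_fps (\<lambda>j. if k dvd j then of_nat (j div k) * c ^ j else 0)" (is "_ = ?W")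
proof -
  (* Pulling out the scalar turns multiplication by u into an index shift. *)
  have u: "u = fps_const (c ^ k) * fps_X ^ k"
    by (simp add: u_def power_mult_distrib)
  have un: "(f * u) $ j = (if j < k then 0 else c ^ k * f $ (j - k))" for f j
    unfolding u by (simp add: mult.left_commute[of f] fps_X_power_mult_right_nth)
  have u0: "(1 - u) $ 0 = 1" using assms(1) by (simp add: u)
  have dv: "k dvd j - k \<longleftrightarrow> k dvd j" if "k \<le> j" for j
    using that by (meson dvd_minus_self leD)
  have pw: "c ^ k * c ^ (j - k) = c ^ j" if "k \<le> j" for j
    using that by (simp flip: power_add)
  have V: "?V * (1 - u) = u"
  proof (rule fps_ext)
    fix j
    have ui: "u $ j = (if j = k then c ^ k else 0)" by (simp add: u fps_X_power_nth)
    show "(?V * (1 - u)) $ j = u $ j"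
      using assms(1) by (auto simp: right_diff_distrib un ui dv pw dest: dvd_imp_le)
  qed
  have W: "?W * (1 - u) = ?V"
  proof (rule fps_ext)
    fix j
    show "(?W * (1 - u)) $ j = ?V $ j"
    proof (cases "k \<le> j \<and> k dvd j")
      case True
      then obtain m where "j = k * Suc m"
        by (metis assms(1) dvd_def le_zero_eq mult_0_right not0_implies_Suc not_one_le_zero)
      moreover have "k * Suc m - k = k * m" by simp
      ultimately show ?thesis
        using assms(1) by (simp add: right_diff_distrib un power_add distrib_right)
    next
      case False
      then show ?thesis
        using assms(1) by (auto simp: right_diff_distrib un dv not_le dest: dvd_imp_le)
    qed
  qed
  show "u / (1 - u) = ?V"
    using V u0 by (intro fps_divide_eqI) auto
  have "(1 - u) ^ 2 $ 0 = 1"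
    using u0 by (simp add: fps_nth_power_0)
  then show "u / (1 - u) ^ 2 = ?W"
    using V W by (intro fps_divide_eqI) (auto simp: power2_eq_square mult.assoc[symmetric])
qed

text \<open>
  Up to the factor \<open>c ^ j\<close>, the coefficient of index \<open>j > 0\<close> is on the left the sum of the divisors
  \<open>k\<close> of \<open>j\<close> and on the right the sum of the cofactors \<open>j div k\<close>, which are the same divisors in
  another order.
\<close>

lemma lambert_series_identity:
  fixes c :: "'a::field"
  defines "x \<equiv> fps_const c * fps_X"
  shows "(\<lambda>N. \<Sum>k=1..N. of_nat k * (x ^ k / (1 - x ^ k)))
    \<longlonglongrightarrow> (\<Sum>n. x ^ Suc n / (1 - x ^ Suc n) ^ 2)"
proof -
  define F :: "'a fps" where "F = Abs_fps (\<lambda>j. if j = 0 then 0 else (\<Sum>d | d dvd j. of_nat d) * c ^ j)"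
  have divisors: "{k. k \<in> {1..N} \<and> k dvd j} = {d. d dvd j}" if "j \<le> N" "j \<noteq> 0" for N j :: nat
    using that by (auto dest: dvd_imp_le intro: order_trans simp: Suc_le_eq intro!: Nat.gr0I)
  have T: "(\<Sum>k=1..N. of_nat k * (x ^ k / (1 - x ^ k))) $ j = F $ j" if "j \<le> N" for N j
  proof -
    have "(\<Sum>k=1..N. of_nat k * (x ^ k / (1 - x ^ k))) $ j
        = (\<Sum>k=1..N. if j \<ge> 1 \<and> k dvd j then of_nat k * c ^ j else 0)"
      unfolding fps_sum_nth x_def
      by (rule sum.cong) (auto simp: fps_geometric_power_series(1) simp flip: fps_of_nat)
    also have "\<dots> = (\<Sum>k | k \<in> {1..N} \<and> j \<ge> 1 \<and> k dvd j. of_nat k * c ^ j)"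
      by (rule sum.inter_filter[symmetric]) simp
    also have "\<dots> = F $ j"
    proof (cases "j = 0")
      case False
      have "{k. k \<in> {1..N} \<and> j \<ge> 1 \<and> k dvd j} = {d. d dvd j}"
        using False divisors[OF that] by auto
      with False show ?thesis by (simp add: F_def sum_distrib_right)
    qed (simp add: F_def)
    finally show ?thesis .
  qed
  have W: "(\<Sum>n<N. x ^ Suc n / (1 - x ^ Suc n) ^ 2) $ j = F $ j" if "j \<le> N" for N j
  proof -
    have "(\<Sum>n<N. x ^ Suc n / (1 - x ^ Suc n) ^ 2) $ j
        = (\<Sum>k=1..N. ((x ^ k / (1 - x ^ k) ^ 2) $ j))"
      unfolding fps_sum_nth One_nat_def sum.atLeast1_atMost_eq ..
    also have "\<dots> = (\<Sum>k=1..N. if k dvd j then of_nat (j div k) * c ^ j else 0)"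
      unfolding x_def by (rule sum.cong) (auto simp: fps_geometric_power_series(2))
    also have "\<dots> = (\<Sum>k | k \<in> {1..N} \<and> k dvd j. of_nat (j div k) * c ^ j)"
      by (rule sum.inter_filter[symmetric]) simp
    also have "\<dots> = F $ j"
    proof (cases "j = 0")
      case False
      have "(\<Sum>k | k \<in> {1..N} \<and> k dvd j. of_nat (j div k) * c ^ j)
          = (\<Sum>k | k dvd j. of_nat (j div k) * c ^ j)"
        by (simp only: divisors[OF that False])
      also have "\<dots> = (\<Sum>d | d dvd j. of_nat d * c ^ j)"
        by (rule sum.reindex_bij_witness[of _ "\<lambda>d. j div d" "\<lambda>d. j div d"]) (use False in auto)
      finally show ?thesis using False by (simp add: F_def sum_distrib_right)
    qed (simp add: F_def)
    finally show ?thesis .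
  qed
  have "(\<lambda>n. x ^ Suc n / (1 - x ^ Suc n) ^ 2) sums F"
    unfolding sums_def by (rule tendsto_fps_if_nth_stable) (rule W)
  then have "(\<Sum>n. x ^ Suc n / (1 - x ^ Suc n) ^ 2) = F"
    by (rule sums_unique[symmetric])
  moreover have "(\<lambda>N. \<Sum>k=1..N. of_nat k * (x ^ k / (1 - x ^ k))) \<longlonglongrightarrow> F"
    by (rule tendsto_fps_if_nth_stable) (rule T)
  ultimately show ?thesis by simp
qed

section \<open>Partitions with bounded parts\<close>

definition bounded_partitions :: "nat set \<Rightarrow> nat \<Rightarrow> nat \<Rightarrow> nat list set" where
  "bounded_partitions D N n = {xs \<in> partitions_distinct_in D n. set xs \<subseteq> {..N}}"

lemma finite_bounded_partitions: "finite (bounded_partitions D N n)"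
  unfolding bounded_partitions_def
  by (rule finite_subset[OF _ finite_partitions_distinct_in[of D n]]) auto

lemma bounded_partitions_eq:
  assumes "n \<le> N"
  shows "bounded_partitions D N n = partitions_distinct_in D n"
proof -
  have "set xs \<subseteq> {..N}" if "xs \<in> partitions_distinct_in D n" for xs
  proof
    fix x assume "x \<in> set xs"
    then have "x \<le> sum_list xs" by (simp add: member_le_sum_list)
    also have "\<dots> = n" using that by (simp add: partitions_distinct_in_def partitions_def)
    finally show "x \<in> {..N}" using assms by simp
  qed
  then show ?thesis by (auto simp: bounded_partitions_def)
qed

text \<open>
  Removing one copy of the largest admissible part \<open>N + 1\<close> leaves parts at most \<open>N\<close> if this part
  must not repeat, and parts at most \<open>N + 1\<close> otherwise. All recursions below rest on this case
  distinction.
\<close>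

lemma Cons_in_bounded_partitions_iff:
  "Suc N # xs \<in> bounded_partitions D (Suc N) n \<longleftrightarrow>
     Suc N \<le> n \<and> xs \<in> bounded_partitions D (if Suc N \<in> D then N else Suc N) (n - Suc N)"
proof -
  have count: "(\<forall>d\<in>D. count_list (Suc N # xs) d \<le> 1) \<longleftrightarrow>
      (\<forall>d\<in>D. count_list xs d \<le> 1) \<and> (Suc N \<in> D \<longrightarrow> Suc N \<notin> set xs)"
  proof -
    have "count_list (Suc N # xs) d \<le> 1 \<longleftrightarrow>
        count_list xs d \<le> 1 \<and> (d = Suc N \<longrightarrow> Suc N \<notin> set xs)" for d
      using count_list_0_iff[of xs "Suc N"] by auto
    then show ?thesis by blast
  qed
  have bound: "set xs \<subseteq> {..N} \<longleftrightarrow> set xs \<subseteq> {..Suc N} \<and> Suc N \<notin> set xs"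
    by (auto simp: atMost_Suc)
  have sorted: "sorted_wrt (\<ge>) (Suc N # xs) \<and> set (Suc N # xs) \<subseteq> {..Suc N} \<longleftrightarrow>
      sorted_wrt (\<ge>) xs \<and> set xs \<subseteq> {..Suc N}"
    by auto
  have size: "sum_list (Suc N # xs) = n \<longleftrightarrow> Suc N \<le> n \<and> sum_list xs = n - Suc N"
    by auto
  have pos: "(\<forall>x\<in>set (Suc N # xs). 1 \<le> x) \<longleftrightarrow> (\<forall>x\<in>set xs. 1 \<le> x)"
    by simp
  show ?thesis
    unfolding bounded_partitions_def partitions_distinct_in_def partitions_def mem_Collect_eq
      count size pos
    using sorted bound by (cases "Suc N \<in> D") (simp_all only: if_True if_False simp_thms, blast+)
qed

lemma bounded_partitions_Suc:
  "bounded_partitions D (Suc N) n = bounded_partitions D N n \<union>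
     (if n < Suc N then {} else
        (#) (Suc N) ` bounded_partitions D (if Suc N \<in> D then N else Suc N) (n - Suc N))"
  (is "?L = ?M \<union> ?R")
proof (intro equalityI subsetI)
  fix xs assume xs: "xs \<in> ?L"
  show "xs \<in> ?M \<union> ?R"
  proof (cases "Suc N \<in> set xs")
    case False
    with xs show ?thesis
      by (auto simp: bounded_partitions_def le_Suc_eq subset_iff)
  next
    case True
    then obtain y ys where y: "xs = y # ys" by (cases xs) auto
    with xs True have "y = Suc N"
      by (auto simp: bounded_partitions_def partitions_distinct_in_def partitions_def)
    with xs y show ?thesis
      using Cons_in_bounded_partitions_iff[of N ys D n] by auto
  qed
next
  fix xs assume "xs \<in> ?M \<union> ?R"
  then show "xs \<in> ?L"
    using Cons_in_bounded_partitions_iff[of N _ D n]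
    by (auto simp: bounded_partitions_def split: if_splits)
qed

lemma sum_bounded_partitions_Suc:
  fixes f :: "nat list \<Rightarrow> 'a::comm_monoid_add"
  shows "sum f (bounded_partitions D (Suc N) n) = sum f (bounded_partitions D N n) +
    (if n < Suc N then 0 else
       \<Sum>xs\<in>bounded_partitions D (if Suc N \<in> D then N else Suc N) (n - Suc N). f (Suc N # xs))"
proof -
  have "Suc N # xs \<notin> bounded_partitions D N n" for xs
    by (auto simp: bounded_partitions_def)
  then show ?thesis
    unfolding bounded_partitions_Suc
    by (subst sum.union_disjoint) (auto simp: finite_bounded_partitions sum.reindex)
qed

lemma bounded_partitions_0: "bounded_partitions D 0 n = (if n = 0 then {[]} else {})"
proof -
  have "xs = []" if "xs \<in> bounded_partitions D 0 n" for xs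
    using that by (cases xs) (auto simp: bounded_partitions_def partitions_distinct_in_def partitions_def)
  moreover have "[] \<in> bounded_partitions D 0 n \<longleftrightarrow> n = 0"
    by (auto simp: bounded_partitions_def partitions_distinct_in_def partitions_def)
  ultimately show ?thesis by auto
qed

section \<open>Generating functions of bounded partitions\<close>

definition count_fps :: "nat set \<Rightarrow> nat \<Rightarrow> 'a::field fps" where
  "count_fps D N = Abs_fps (\<lambda>n. \<Sum>xs\<in>bounded_partitions D N n. 1)"

definition weight_fps :: "nat set \<Rightarrow> nat \<Rightarrow> 'a::field fps" where
  "weight_fps D N = Abs_fps (\<lambda>n. \<Sum>xs\<in>bounded_partitions D N n. of_int (odd_minus_even xs))"

lemma count_fps_0: "count_fps D 0 = 1"
  by (rule fps_ext) (simp add: count_fps_def bounded_partitions_0)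

lemma weight_fps_0: "weight_fps D 0 = 0"
  by (rule fps_ext) (simp add: weight_fps_def bounded_partitions_0 odd_minus_even_def)

lemma count_fps_Suc:
  "count_fps D (Suc N) =
     count_fps D N + fps_X ^ Suc N * count_fps D (if Suc N \<in> D then N else Suc N)"
  by (rule fps_ext)
    (simp add: count_fps_def sum_bounded_partitions_Suc fps_X_power_mult_nth del: power_Suc sum_constant)

lemma odd_minus_even_Cons:
  "odd_minus_even (k # xs) = (- 1) ^ Suc k * int k + odd_minus_even xs"
  by (simp add: odd_minus_even_def)

text \<open>
  Besides the weight of the remaining partition, the removed part \<open>N + 1\<close> contributes itself with
  sign \<open>(- 1)\<^sup>N\<close>, once for every remaining partition. This is where \<open>count_fps\<close> enters.
\<close>

lemma weight_fps_Suc: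
  fixes D :: "nat set" and N :: nat
  defines "M \<equiv> if Suc N \<in> D then N else Suc N"
  shows "weight_fps D (Suc N) = weight_fps D N +
     fps_X ^ Suc N * (weight_fps D M + (- 1) ^ N * of_nat (Suc N) * count_fps D M)"
proof (rule fps_ext)
  fix n
  have c: "(- 1) ^ N * of_nat (Suc N) = (fps_const ((- 1) ^ N * of_nat (Suc N)) :: 'a fps)"
    by (simp only: fps_of_nat fps_const_1_eq_1
        flip: fps_const_mult fps_const_power fps_const_neg)
  have sgn: "(- 1) ^ Suc (Suc N) = ((- 1) ^ N :: 'a)" by simp
  show "weight_fps D (Suc N) $ n = (weight_fps D N +
     fps_X ^ Suc N * (weight_fps D M + (- 1) ^ N * of_nat (Suc N) * count_fps D M) :: 'a fps) $ n"
    unfolding c M_def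
    by (simp add: weight_fps_def count_fps_def sum_bounded_partitions_Suc fps_X_power_mult_nth
        odd_minus_even_Cons sum.distrib sgn mult.commute del: power_Suc of_nat_Suc)
qed

lemma count_fps_LIMSEQ: "count_fps D \<longlonglongrightarrow> Abs_fps (\<lambda>n. of_nat (card (partitions_distinct_in D n)))"
  by (rule tendsto_fps_if_nth_stable) (simp add: count_fps_def bounded_partitions_eq)

lemma weight_fps_LIMSEQ: "weight_fps D \<longlonglongrightarrow> Abs_fps (\<lambda>n. of_int (S D n))"
  by (rule tendsto_fps_if_nth_stable) (simp add: weight_fps_def bounded_partitions_eq S_def)

section \<open>Distinct odd parts\<close>

text \<open>
  Only even bounds \<open>2 * M\<close> are considered: then the admissible odd parts are \<open>2 * i + 1\<close> and the
  even ones \<open>2 * i + 2\<close> with \<open>i < M\<close>, so both products have \<open>M\<close> factors and are the partial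
  products of the two q-Pochhammer symbols.
\<close>

lemma count_fps_odd:
  "count_fps {k. odd k} (2 * M) * (\<Prod>i<M. 1 - fps_X ^ 2 * (fps_X ^ 2) ^ i)
     = (\<Prod>i<M. 1 - (- fps_X) * (fps_X ^ 2) ^ i :: 'a::field fps)"
proof (induction M)
  case 0
  show ?case by (simp add: count_fps_0)
next
  case (Suc M)
  let ?A = "count_fps {k. odd k} :: nat \<Rightarrow> 'a fps"
  have 1: "?A (Suc (2 * M)) = ?A (2 * M) * (1 - (- fps_X) * (fps_X ^ 2) ^ M)"
    
  proof -
    have "fps_X ^ Suc (2 * M) = fps_X * ((fps_X ^ 2) ^ M :: 'a fps)"
      by (simp only: power_Suc power_mult)
    then show ?thesis
      by (subst count_fps_Suc) (simp add: algebra_simps del: power_Suc)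
  qed
  have 2: "?A (2 * Suc M) * (1 - fps_X ^ 2 * (fps_X ^ 2) ^ M) = ?A (Suc (2 * M))"
  proof -
    have "fps_X ^ Suc (Suc (2 * M)) = fps_X ^ 2 * ((fps_X ^ 2) ^ M :: 'a fps)"
      by (simp only: power_Suc power_mult power2_eq_square mult.assoc)
    then have "?A (Suc (Suc (2 * M))) =
        ?A (Suc (2 * M)) + fps_X ^ 2 * (fps_X ^ 2) ^ M * ?A (Suc (Suc (2 * M)))"
      by (subst count_fps_Suc) (simp del: power_Suc)
    moreover have "a * (1 - y) = b" if "a = b + y * a" for a b y :: "'a fps"
      using that by (simp add: algebra_simps)
    ultimately show ?thesis
      by simp
  qed
  have "?A (2 * Suc M) * (\<Prod>i<Suc M. 1 - fps_X ^ 2 * (fps_X ^ 2) ^ i)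
      = ?A (2 * Suc M) * (1 - fps_X ^ 2 * (fps_X ^ 2) ^ M) * (\<Prod>i<M. 1 - fps_X ^ 2 * (fps_X ^ 2) ^ i)"
    by (simp only: prod.lessThan_Suc ac_simps)
  also have "\<dots> = ?A (2 * M) * (\<Prod>i<M. 1 - fps_X ^ 2 * (fps_X ^ 2) ^ i) * (1 - (- fps_X) * (fps_X ^ 2) ^ M)"
    unfolding 2 1 by (simp only: ac_simps)
  also have "\<dots> = (\<Prod>i<Suc M. 1 - (- fps_X) * (fps_X ^ 2) ^ i)"
    by (simp only: Suc.IH prod.lessThan_Suc)
  finally show ?case .
qed

text \<open>
  This is the logarithmic derivative of the finite product. The choice \<open>x = - q\<close> gives odd and even
  parts the same summand: with \<open>u = x\<^sup>k\<close>, an odd part \<open>k\<close> multiplies \<open>count_fps\<close> by \<open>1 - u\<close>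
  and an even part divides it by \<open>1 - u\<close>.
\<close>

lemma weight_fps_odd:
  fixes x :: "'a::field fps"
  defines "x \<equiv> - fps_X"
  shows "weight_fps {k. odd k} N
     = - count_fps {k. odd k} N * (\<Sum>k=1..N. of_nat k * (x ^ k / (1 - x ^ k)))"
proof (induction N)
  case 0
  show ?case by (simp add: weight_fps_0)
next
  case (Suc N)
  let ?A = "count_fps {k. odd k} :: nat \<Rightarrow> 'a fps"
  let ?B = "weight_fps {k. odd k} :: nat \<Rightarrow> 'a fps"
  define L where "L = (\<Sum>k=1..N. of_nat k * (x ^ k / (1 - x ^ k)))"
  define u where "u = x ^ Suc N"
  define k :: "'a fps" where "k = of_nat (Suc N)"
  define t where "t = u / (1 - u)"
  have u0: "(1 - u) $ 0 = 1" by (simp add: u_def x_def)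
  then have nz: "1 - u \<noteq> 0" by auto
  have t: "t * (1 - u) = u"
    unfolding t_def using u0 by (simp add: fps_divide_unit mult.assoc inverse_mult_eq_1)
  have IH: "?B N = - ?A N * L" using Suc by (simp add: L_def)
  have "?B (Suc N) = - ?A (Suc N) * (L + k * t)"
  proof (cases "odd (Suc N)")
    case True
    then have y: "fps_X ^ Suc N = - u" by (simp add: u_def x_def)
    have A: "?A (Suc N) = ?A N * (1 - u)"
      using True by (subst count_fps_Suc) (simp add: y algebra_simps del: power_Suc)
    have "?B (Suc N) = ?B N - u * (?B N + k * ?A N)"
      using True by (subst weight_fps_Suc) (simp add: y k_def del: power_Suc of_nat_Suc)
    also have "\<dots> = - ?A N * (1 - u) * L - k * ?A N * u"
      unfolding IH by (simp add: algebra_simps)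
    also have "\<dots> = - ?A (Suc N) * L - k * ?A N * (t * (1 - u))"
      unfolding A t by simp
    finally show ?thesis unfolding A by (simp add: algebra_simps)
  next
    case False
    then have y: "fps_X ^ Suc N = u" by (simp add: u_def x_def)
    have "?A (Suc N) = ?A N + u * ?A (Suc N)"
      using False by (subst count_fps_Suc) (simp add: y del: power_Suc)
    then have A: "?A N = ?A (Suc N) * (1 - u)" by (simp add: algebra_simps)
    have "?B (Suc N) = ?B N + u * (?B (Suc N) - k * ?A (Suc N))"
      using False by (subst weight_fps_Suc) (simp add: y k_def del: power_Suc of_nat_Suc)
    then have "?B (Suc N) * (1 - u) = ?B N - k * ?A (Suc N) * u"
      by (simp add: algebra_simps)
    also have "\<dots> = - ?A (Suc N) * (1 - u) * L - k * ?A (Suc N) * (t * (1 - u))"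
      unfolding IH A t by simp
    also have "\<dots> = - ?A (Suc N) * (L + k * t) * (1 - u)"
      by (simp add: algebra_simps)
    finally show ?thesis
      using nz mult_right_cancel by blast
  qed
  then show ?case
    by (simp add: L_def k_def t_def u_def del: power_Suc of_nat_Suc)
qed

theorem theorem3p1:
  shows "Abs_fps (\<lambda>n. if n \<ge> 1 then of_int (S {k. odd k} n) else 0) =
    - (qpochhammer_inf (- fps_X) (fps_X ^ 2) / qpochhammer_inf (fps_X ^ 2) (fps_X ^ 2)) *
      (\<Sum>n. (- fps_X) ^ Suc n / (1 - (- fps_X) ^ Suc n) ^ 2 :: rat fps)"
proof -
  let ?D = "{k. odd k}"
  define A :: "rat fps" where "A = Abs_fps (\<lambda>n. of_nat (card (partitions_distinct_in ?D n)))"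
  define B :: "rat fps" where "B = Abs_fps (\<lambda>n. of_int (S ?D n))"
  define P :: "rat fps" where "P = qpochhammer_inf (- fps_X) (fps_X ^ 2)"
  define E :: "rat fps" where "E = qpochhammer_inf (fps_X ^ 2) (fps_X ^ 2)"
  define L :: "rat fps" where "L = (\<Sum>n. (- fps_X) ^ Suc n / (1 - (- fps_X) ^ Suc n) ^ 2)"
  have A: "count_fps ?D \<longlonglongrightarrow> A"
    unfolding A_def by (rule count_fps_LIMSEQ)
  have E: "(\<lambda>M. \<Prod>i<M. 1 - fps_X ^ 2 * (fps_X ^ 2) ^ i) \<longlonglongrightarrow> E"
    unfolding E_def by (rule qpochhammer_inf_LIMSEQ) simp_all
  have "(\<lambda>M. count_fps ?D (2 * M)) \<longlonglongrightarrow> A"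
    using LIMSEQ_subseq_LIMSEQ[OF A, of "\<lambda>M. 2 * M"] by (simp add: strict_mono_def o_def)
  from tendsto_fps_mult[OF this E]
  have "(\<lambda>M. \<Prod>i<M. 1 - (- fps_X) * (fps_X ^ 2) ^ i) \<longlonglongrightarrow> A * E"
    unfolding count_fps_odd .
  moreover have "(\<lambda>M. \<Prod>i<M. 1 - (- fps_X) * (fps_X ^ 2) ^ i) \<longlonglongrightarrow> P"
    unfolding P_def by (rule qpochhammer_inf_LIMSEQ) simp_all
  ultimately have AE: "A * E = P"
    by (rule LIMSEQ_unique)
  have "E $ 0 = 1"
    unfolding E_def by (rule qpochhammer_inf_nth_0) simp_all
  with AE have PE: "P / E = A"
    by (intro fps_divide_eqI) auto
  have x: "fps_const (- 1) * fps_X = (- fps_X :: rat fps)" by simp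
  have "(\<lambda>N. \<Sum>k=1..N. of_nat k * ((- fps_X) ^ k / (1 - (- fps_X) ^ k))) \<longlonglongrightarrow> L"
    using lambert_series_identity[of "- 1 :: rat"] unfolding x L_def .
  from tendsto_fps_mult[OF tendsto_fps_mult[OF tendsto_const[of "- 1"] A] this]
  have "weight_fps ?D \<longlonglongrightarrow> - A * L"
    unfolding weight_fps_odd[abs_def] by simp
  moreover have "weight_fps ?D \<longlonglongrightarrow> B"
    unfolding B_def by (rule weight_fps_LIMSEQ)
  ultimately have "B = - A * L"
    by (intro LIMSEQ_unique)
  moreover have "Abs_fps (\<lambda>n. if n \<ge> 1 then of_int (S ?D n) else 0) = B"
  proof -
    (* The empty partition has weight 0, which is the constant coefficient of the left-hand side. *)
    have "partitions_distinct_in ?D 0 = {[]}"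
      using bounded_partitions_eq[of 0 0 ?D] by (simp add: bounded_partitions_0)
    then have "S ?D 0 = 0"
      by (simp add: S_def odd_minus_even_def)
    then show ?thesis by (auto simp: B_def fps_eq_iff Suc_le_eq)
  qed
  ultimately show ?thesis
    using PE by (simp add: P_def E_def L_def)
qed

end
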